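(* Let $X$ be a real Hilbert space, let $A_1,A_2$ be maximally monotone operators on $X$ and $B$ a $\beta$-cocoercive operator on $X$ ($\beta>0$) such that $\operatorname{zer}(A_1+A_2+B)\neq\varnothing$. Let $\Gamma\subseteq(0,\frac2\beta)$, let $(\gamma_k)_{k\in\mathbb{N}}$ be a sequence in $\Gamma$ and $\bar\gamma\in\Gamma$ with $\gamma_k\to\bar\gamma$ and $\sum_{k\in\mathbb{N}}(\gamma_{k+1}-\gamma_k)_+<+\infty$. Let $(\theta_k)_{k\in\mathbb{N}}$ be a bounded sequence in $(0,+\infty)$ separated from zero, and $(\lambda_k)_{k\in\mathbb{N}}$ a sequence in $(0,+\infty)$ separated from zero, such that $\liminf_k(2-\beta\gamma_k-2\lambda_k\theta_k)>0$. Given $z_0\in X$, set $x_0=J_{\gamma_0A_1}z_0$ and for $k=0,1,2,\dots$ $$\begin{aligned}y_k&=J_{\gamma_kA_2}(2x_k-z_k-\gamma_kBx_k),& w_k&=z_k+\lambda_k\theta_k(y_k-x_k),\\ x_{k+1}&=J_{\gamma_kA_1}w_k,& z_{k+1}&=\tfrac{\gamma_{k+1}}{\gamma_k}w_k+\big(1-\tfrac{\gamma_{k+1}}{\gamma_k}\big)x_{k+1}.\end{aligned}$$ Then: (i) $(z_k)_{k\in\mathbb{N}}$ and $(w_k)_{k\in\mathbb{N}}$ converge to the same point $\bar z\in\operatorname{Fix}T^{DY}_{\liminf_k\theta_k,\bar\gamma}$. (ii) $(x_k)_{k\in\mathbb{N}}$ and $(y_k)_{k\in\mathbb{N}}$ converge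 to the same point $\bar x=J_{\bar\gamma A_1}(\bar z)\in\operatorname{zer}(A_1+A_2+B)$.
   Context: $J_A=(\mathrm{Id}+A)^{-1}$, $\operatorname{zer}A=\{x:0\in Ax\}$, $\operatorname{Fix}T=\{x:Tx=x\}$, $(a)_+=\max\{a,0\}$. A positive sequence is separated from zero if bounded below by a positive constant. The convention for cocoercivity is: $B:X\to X$ is $\beta$-cocoercive if $\langle Bx-By,x-y\rangle\ge\frac1\beta\|Bx-By\|^2$ for all $x,y$. For $\theta,\gamma>0$ the Davis–Yin operator is $T^{DY}_{\theta,\gamma}z=z-\theta(x_1^\gamma(z)-x_2^\gamma(z))$, where $x_1^\gamma(z)=J_{\gamma A_1}(z)$ and $x_2^\gamma(z)=J_{\gamma A_2}\big(2x_1^\gamma(z)-z-\gamma Bx_1^\gamma(z)\big)$.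
   Formalization: Convergence of z_k, w_k, x_k, y_k is taken as weak convergence; norm convergence fails in general in infinite-dimensional Hilbert spaces (relaxed proximal point iteration, A_1=0, B=0), while in finite dimension the two notions coincide. *)

theory Defs
  imports "HOL-Analysis.Analysis"
begin

text \<open>
  Set-valued operators on \<open>X\<close> are functions \<^typ>\<open>'a \<Rightarrow> 'a set\<close>; a single-valued \<open>B\<close> enters sums
  as \<open>\<lambda>x. {B x}\<close>.
\<close>

definition op_add :: "('a::real_inner \<Rightarrow> 'a set) \<Rightarrow> ('a \<Rightarrow> 'a set) \<Rightarrow> 'a \<Rightarrow> 'a set" where
  "op_add A B x = {u + v | u v. u \<in> A x \<and> v \<in> B x}"

definition op_scale :: "real \<Rightarrow> ('a::real_inner \<Rightarrow> 'a set) \<Rightarrow> 'a \<Rightarrow> 'a set" where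
  "op_scale c A x = (\<lambda>u. c *\<^sub>R u) ` A x"

definition op_inverse :: "('a \<Rightarrow> 'a set) \<Rightarrow> 'a \<Rightarrow> 'a set" where
  "op_inverse A u = {x. u \<in> A x}"

definition zer :: "('a::real_inner \<Rightarrow> 'a set) \<Rightarrow> 'a set" where
  "zer A = {x. 0 \<in> A x}"

definition Fix :: "('a \<Rightarrow> 'a) \<Rightarrow> 'a set" where
  "Fix T = {x. T x = x}"

definition monotone_op :: "('a::real_inner \<Rightarrow> 'a set) \<Rightarrow> bool" where
  "monotone_op A \<longleftrightarrow> (\<forall>x y. \<forall>u\<in>A x. \<forall>v\<in>A y. inner (u - v) (x - y) \<ge> 0)"

definition maximally_monotone :: "('a::real_inner \<Rightarrow> 'a set) \<Rightarrow> bool" where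
  "maximally_monotone A \<longleftrightarrow>
     monotone_op A \<and> (\<forall>A'. monotone_op A' \<and> (\<forall>x. A x \<subseteq> A' x) \<longrightarrow> A' = A)"

text \<open>The constant enters as \<open>1/\<beta>\<close>, so a \<open>\<beta>\<close>-cocoercive map is \<open>\<beta>\<close>-Lipschitz.\<close>

definition cocoercive :: "real \<Rightarrow> ('a::real_inner \<Rightarrow> 'a) \<Rightarrow> bool" where
  "cocoercive \<beta> B \<longleftrightarrow>
     (\<forall>x y. inner (B x - B y) (x - y) \<ge> (1 / \<beta>) * (norm (B x - B y))\<^sup>2)"

text \<open>
  \<open>(Id + A)\<inverse>\<close> is set-valued in general; for maximally monotone \<open>A\<close> on a Hilbert space it is
  single-valued and everywhere defined (Minty), and \<open>resolvent A z\<close> is its unique value at \<open>z\<close>.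
\<close>

definition resolvent :: "('a::real_inner \<Rightarrow> 'a set) \<Rightarrow> 'a \<Rightarrow> 'a" where
  "resolvent A z = (THE x. x \<in> op_inverse (op_add (\<lambda>x. {x}) A) z)"

definition DY_x1 :: "real \<Rightarrow> ('a::real_inner \<Rightarrow> 'a set) \<Rightarrow> 'a \<Rightarrow> 'a" where
  "DY_x1 \<gamma> A1 z = resolvent (op_scale \<gamma> A1) z"

definition DY_x2 ::
  "real \<Rightarrow> ('a::real_inner \<Rightarrow> 'a set) \<Rightarrow> ('a \<Rightarrow> 'a set) \<Rightarrow> ('a \<Rightarrow> 'a) \<Rightarrow> 'a \<Rightarrow> 'a" where
  "DY_x2 \<gamma> A1 A2 B z =
     resolvent (op_scale \<gamma> A2) (2 *\<^sub>R DY_x1 \<gamma> A1 z - z - \<gamma> *\<^sub>R B (DY_x1 \<gamma> A1 z))"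

definition davis_yin ::
  "real \<Rightarrow> real \<Rightarrow> ('a::real_inner \<Rightarrow> 'a set) \<Rightarrow> ('a \<Rightarrow> 'a set) \<Rightarrow> ('a \<Rightarrow> 'a) \<Rightarrow> 'a \<Rightarrow> 'a" where
  "davis_yin \<theta> \<gamma> A1 A2 B z = z - \<theta> *\<^sub>R (DY_x1 \<gamma> A1 z - DY_x2 \<gamma> A1 A2 B z)"

definition separated_from_zero :: "(nat \<Rightarrow> real) \<Rightarrow> bool" where
  "separated_from_zero a \<longleftrightarrow> (\<exists>c>0. \<forall>k. c \<le> a k)"

text \<open>
  Convergence of iterates in the Hilbert space is weak convergence. Norm convergence already fails
  in general for the (relaxed) proximal point iteration, the special case \<open>A1 = 0\<close>, \<open>B = 0\<close>.
  In finite dimension the two notions coincide.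
\<close>

definition weakly_converges :: "(nat \<Rightarrow> 'a::real_inner) \<Rightarrow> 'a \<Rightarrow> bool" where
  "weakly_converges u l \<longleftrightarrow> (\<forall>v. (\<lambda>k. inner (u k) v) \<longlonglongrightarrow> inner l v)"

lemma weakly_converges_iff_tendsto:
  fixes u :: "nat \<Rightarrow> 'a::euclidean_space"
  shows "weakly_converges u l \<longleftrightarrow> u \<longlonglongrightarrow> l"
proof
  assume "weakly_converges u l"
  then show "u \<longlonglongrightarrow> l"
    by (subst tendsto_componentwise_iff) (simp add: weakly_converges_def)
next
  assume "u \<longlonglongrightarrow> l"
  then show "weakly_converges u l"
    unfolding weakly_converges_def by (intro allI tendsto_inner tendsto_const)
qed

end

theory Submission
  imports Defs
begin

text \<open>
  Put \<open>a\<^sub>k = (z\<^sub>k - x\<^sub>k) / \<gamma>\<^sub>k\<close> and \<open>b\<^sub>k = (x\<^sub>k - y\<^sub>k) / \<gamma>\<^sub>k - a\<^sub>k - B x\<^sub>k\<close>, so that \<open>a\<^sub>k \<in> A1 x\<^sub>k\<close> and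
  \<open>b\<^sub>k \<in> A2 y\<^sub>k\<close>. The update of \<open>z\<close> only replaces \<open>w\<^sub>k = x\<^sub>k\<^sub>+\<^sub>1 + \<gamma>\<^sub>k a\<^sub>k\<^sub>+\<^sub>1\<close> by \<open>x\<^sub>k\<^sub>+\<^sub>1 + \<gamma>\<^sub>k\<^sub>+\<^sub>1 a\<^sub>k\<^sub>+\<^sub>1\<close>.
  For a zero \<open>p\<close> with \<open>u \<in> A1 p\<close> and \<open>- u - B p \<in> A2 p\<close>, the squared distance of \<open>z\<^sub>k\<close> to the moving point
  \<open>p + \<gamma>\<^sub>k u\<close> therefore decreases by a multiple of \<open>\<parallel>x\<^sub>k - y\<^sub>k\<parallel>\<^sup>2\<close>, up to a factor
  \<open>1 + O((\<gamma>\<^sub>k\<^sub>+\<^sub>1 - \<gamma>\<^sub>k)\<^sub>+)\<close>. Hence it converges, \<open>x\<^sub>k - y\<^sub>k \<rightarrow> 0\<close>, and cocoercivity gives \<open>B x\<^sub>k \<rightarrow> B p\<close> in norm.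
  This makes every weak cluster point of \<open>(x\<^sub>k, z\<^sub>k)\<close> a zero together with the corresponding
  fixed point, and Opial's argument shows that there is only one. Weak cluster points are taken
  along filters, since in a nonseparable space this avoids extracting subsequences.
\<close>

section \<open>Minty's theorem\<close>

text \<open>Strong convexity of the quadratic term makes a minimising sequence Cauchy in its first
  component, so a minimiser exists without any compactness. The term in \<open>p - q\<close> records
  quadratic growth away from the minimiser; the Riesz and Minty arguments below both rely on
  it.\<close>

lemma epigraph_strongly_convex_minimiser:
  fixes C :: "('a::{real_inner, complete_space} \<times> real) set"
  assumes "closed C" "convex C" "C \<noteq> {}"
    and bdd: "\<And>p t. (p, t) \<in> C \<Longrightarrow> m \<le> t + (norm p)\<^sup>2 / 2"
  obtains q s where "(q, s) \<in> C"
    "\<And>p t. (p, t) \<in> C \<Longrightarrow> s + (norm q)\<^sup>2 / 2 + (norm (p - q))\<^sup>2 / 2 \<le> t + (norm p)\<^sup>2 / 2"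
proof -
  define f :: "'a \<times> real \<Rightarrow> real" where "f c = snd c + (norm (fst c))\<^sup>2 / 2" for c
  define \<mu> where "\<mu> = Inf (f ` C)"
  have bb: "bdd_below (f ` C)"
    using bdd by (intro bdd_belowI[of _ m]) (auto simp: f_def)
  have \<mu>_le: "\<mu> \<le> f c" if "c \<in> C" for c
    unfolding \<mu>_def using that bb by (auto intro: cInf_lower)
  \<comment> \<open>An identity: \<open>snd\<close> is linear, and the squared norm has an exact
    convexity defect.\<close>
  have f_conv: "f ((1 - r) *\<^sub>R c + r *\<^sub>R d) = (1 - r) * f c + r * f d - r * (1 - r) * (norm (fst d - fst c))\<^sup>2 / 2"
    for c d r
    by (simp add: f_def power2_norm_eq_inner inner_simps inner_commute) (simp add: field_simps)
  have gap: "\<mu> \<le> (1 - r) * f c + r * f d - r * (1 - r) * (norm (fst d - fst c))\<^sup>2 / 2"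
    if "c \<in> C" "d \<in> C" "0 \<le> r" "r \<le> 1" for c d r
  proof -
    have "(1 - r) *\<^sub>R c + r *\<^sub>R d \<in> C"
      using that \<open>convex C\<close> by (intro convexD) auto
    then show ?thesis using \<mu>_le f_conv by metis
  qed
  have "\<exists>c\<in>C. f c < \<mu> + 1 / Suc n" for n
    using cInf_lessD[of "f ` C" "\<mu> + 1 / Suc n"] \<open>C \<noteq> {}\<close> unfolding \<mu>_def by auto
  then obtain c where c: "\<And>n. c n \<in> C" "\<And>n. f (c n) < \<mu> + 1 / Suc n"
    by metis
  have "Cauchy (\<lambda>n. fst (c n))"
    unfolding Cauchy_altdef2
  proof (intro allI impI)
    fix e :: real assume "e > 0"
    \<comment> \<open>At the midpoint, \<open>gap\<close> bounds the squared distance by four times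
      the sum of the two excesses over \<open>\<mu>\<close>; each excess is below
      \<open>e\<^sup>2 / 8\<close>.\<close>
    obtain N where N: "1 / real (Suc N) < e\<^sup>2 / 8"
      using \<open>e > 0\<close> nat_approx_posE[of "e\<^sup>2 / 8"] by auto
    have "dist (fst (c n)) (fst (c N)) < e" if "n \<ge> N" for n
    proof -
      have "1 / real (Suc n) \<le> 1 / real (Suc N)"
        using that by (simp add: field_simps)
      then have *: "f (c n) < \<mu> + e\<^sup>2 / 8" "f (c N) < \<mu> + e\<^sup>2 / 8"
        using c(2)[of n] c(2)[of N] N by linarith+
      have "(norm (fst (c n) - fst (c N)))\<^sup>2 < e\<^sup>2"
        using gap[of "c N" "c n" "1/2"] c(1) * by (simp add: field_simps)
      then show ?thesis
        using \<open>e > 0\<close> by (simp add: dist_norm power_less_imp_less_base)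
    qed
    then show "\<exists>N. \<forall>n\<ge>N. dist (fst (c n)) (fst (c N)) < e" by blast
  qed
  then obtain q where q: "(\<lambda>n. fst (c n)) \<longlonglongrightarrow> q"
    using Cauchy_convergent convergent_def by blast
  have "(\<lambda>n. f (c n)) \<longlonglongrightarrow> \<mu>"
  proof (rule tendsto_sandwich[of "\<lambda>_. \<mu>" _ _ "\<lambda>n. \<mu> + 1 / Suc n"])
    show "(\<lambda>n. \<mu> + 1 / real (Suc n)) \<longlonglongrightarrow> \<mu>"
      using tendsto_add[OF tendsto_const LIMSEQ_Suc[OF lim_1_over_n], of \<mu>] by simp
  qed (use c \<mu>_le in \<open>auto intro!: always_eventually less_imp_le\<close>)
  then have "(\<lambda>n. f (c n) - (norm (fst (c n)))\<^sup>2 / 2) \<longlonglongrightarrow> \<mu> - (norm q)\<^sup>2 / 2"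
    by (intro tendsto_intros q) auto
  then have "(\<lambda>n. snd (c n)) \<longlonglongrightarrow> \<mu> - (norm q)\<^sup>2 / 2"
    by (simp add: f_def)
  from tendsto_Pair[OF q this] have qC: "(q, \<mu> - (norm q)\<^sup>2 / 2) \<in> C"
    using closed_sequentially[OF \<open>closed C\<close>, of c] c(1) by simp
  show thesis
  proof (rule that[OF qC])
    fix p t assume pt: "(p, t) \<in> C"
    \<comment> \<open>Compare the minimiser with the point at parameter \<open>r\<close> on the
      segment towards \<open>(p, t)\<close> and divide by \<open>r\<close>. Letting \<open>r\<close>
      tend to 0 then recovers the full factor 1/2.\<close>
    have "(norm (p - q))\<^sup>2 / 2 * (1 - r) \<le> t + (norm p)\<^sup>2 / 2 - \<mu>" if "0 < r" "r < 1" for r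
    proof -
      have "r * ((norm (p - q))\<^sup>2 / 2 * (1 - r)) \<le> r * (t + (norm p)\<^sup>2 / 2 - \<mu>)"
        using gap[OF qC pt, of r] that by (simp add: f_def algebra_simps)
      then show ?thesis using \<open>0 < r\<close> by (simp only: mult_le_cancel_left_pos)
    qed
    then have "eventually (\<lambda>r. (norm (p - q))\<^sup>2 / 2 * (1 - r) \<le> t + (norm p)\<^sup>2 / 2 - \<mu>) (at_right 0)"
      by (intro eventually_at_rightI[of 0 1]) auto
    moreover have "((\<lambda>r. (norm (p - q))\<^sup>2 / 2 * (1 - r)) \<longlongrightarrow> (norm (p - q))\<^sup>2 / 2 * (1 - 0)) (at_right 0)"
      by (intro tendsto_intros)
    ultimately have "(norm (p - q))\<^sup>2 / 2 * (1 - 0) \<le> t + (norm p)\<^sup>2 / 2 - \<mu>"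
      by (metis tendsto_upperbound trivial_limit_at_right_real)
    then show "\<mu> - (norm q)\<^sup>2 / 2 + (norm q)\<^sup>2 / 2 + (norm (p - q))\<^sup>2 / 2 \<le> t + (norm p)\<^sup>2 / 2"
      by simp
  qed
qed

text \<open>The representing vector is the minimiser of half the squared norm minus
  \<open>L\<close>, found on the epigraph of \<open>- L\<close>. Quadratic growth says that the
  linear functional \<open>g\<close> is bounded below, and such a functional vanishes.\<close>

lemma riesz_representation:
  fixes L :: "'a::{real_inner, complete_space} \<Rightarrow> real"
  assumes "bounded_linear L"
  obtains q where "\<And>v. L v = inner q v"
proof -
  interpret bounded_linear L by fact
  obtain M where M: "\<And>v. norm (L v) \<le> norm v * M" using bounded by blast
  define C where "C = {(p, t). - L p \<le> t}"
  have "closed C"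
    unfolding C_def case_prod_unfold
    by (intro closed_Collect_le continuous_intros continuous_on) 
  moreover have "convex C"
    unfolding convex_def C_def
    by (auto simp: add scale) (smt (verit) mult_left_mono mult_minus_right)
  moreover have "(0, 0) \<in> C" by (simp add: C_def zero)
  \<comment> \<open>Completing the square in \<open>norm p - M\<close> gives the lower
    bound.\<close>
  moreover have "- M\<^sup>2 / 2 \<le> t + (norm p)\<^sup>2 / 2" if "(p, t) \<in> C" for p t
    using that M[of p] sum_squares_ge_zero[of "norm p - M" 0]
    by (auto simp: C_def power2_eq_square algebra_simps)
  ultimately obtain q s where qs: "(q, s) \<in> C"
    "\<And>p t. (p, t) \<in> C \<Longrightarrow> s + (norm q)\<^sup>2 / 2 + (norm (p - q))\<^sup>2 / 2 \<le> t + (norm p)\<^sup>2 / 2"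
    using epigraph_strongly_convex_minimiser[of C] by (metis empty_iff)
  define g where "g p = inner q p - L p" for p
  have g_ge: "g q \<le> g p" for p
    using qs(1) qs(2)[of p "- L p"]
    by (simp add: C_def g_def power2_norm_eq_inner inner_simps inner_commute field_simps)
  have "g v = 0" for v
  proof (rule ccontr)
    assume "g v \<noteq> 0"
    moreover have "g (r *\<^sub>R v) = r * g v" for r
      by (simp add: g_def scale algebra_simps)
    \<comment> \<open>The scaling is chosen so that \<open>g\<close> drops exactly one below its
      minimum \<open>g q\<close>.\<close>
    ultimately have "g (((g q - 1) / g v) *\<^sub>R v) = g q - 1" by simp
    then show False using g_ge[of "((g q - 1) / g v) *\<^sub>R v"] by simp
  qed
  then show thesis using that[of q] by (simp add: g_def)
qed

text \<open>The minimised function is the Fitzpatrick function of \<open>M\<close> plus \<open>\<parallel>\<cdot>\<parallel>\<^sup>2/2\<close> on the product space;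
  its minimiser \<open>(p, q)\<close> yields the graph point \<open>(- q, - p)\<close>.\<close>

lemma minty:
  fixes M :: "('a::{real_inner, complete_space} \<times> 'a) set"
  assumes mono: "\<And>a b c d. (a, b) \<in> M \<Longrightarrow> (c, d) \<in> M \<Longrightarrow> 0 \<le> inner (a - c) (b - d)"
    and maximal: "\<And>p u. (\<And>a b. (a, b) \<in> M \<Longrightarrow> 0 \<le> inner (a - p) (b - u)) \<Longrightarrow> (p, u) \<in> M"
  obtains p where "(p, - p) \<in> M"
proof -
  define C where "C = {((p, u), t). \<forall>(a, b)\<in>M. inner p b + inner a u - inner a b \<le> t}"
  have C_iff: "((p, u), t) \<in> C \<longleftrightarrow> (\<forall>(a, b)\<in>M. inner p b + inner a u - inner a b \<le> t)" for p u t
    by (simp add: C_def)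
  have "C = (\<Inter>(a, b)\<in>M. {c. inner (fst (fst c)) b + inner a (snd (fst c)) - inner a b \<le> snd c})"
    by (auto simp: C_def)
  moreover have "closed \<dots>"
    by (auto intro!: closed_INT closed_Collect_le continuous_intros)
  ultimately have "closed C" by simp
  have "convex C"
  proof (rule convexI)
    fix c d and r s :: real
    assume cd: "c \<in> C" "d \<in> C" and rs: "0 \<le> r" "0 \<le> s" "r + s = 1"
    obtain p u t p' u' t' where e: "c = ((p, u), t)" "d = ((p', u'), t')" by (metis surj_pair)
    have "inner (r *\<^sub>R p + s *\<^sub>R p') b + inner a (r *\<^sub>R u + s *\<^sub>R u') - inner a b \<le> r * t + s * t'"
      if "(a, b) \<in> M" for a b
    proof -
      have "r * (inner p b + inner a u - inner a b) + s * (inner p' b + inner a u' - inner a b) \<le> r * t + s * t'"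
        using cd rs that by (intro add_mono mult_left_mono) (auto simp: e C_iff)
      moreover have "r * inner a b + s * inner a b = inner a b"
        using rs by (metis distrib_right mult_1)
      ultimately show ?thesis by (simp add: inner_simps algebra_simps)
    qed
    then show "r *\<^sub>R c + s *\<^sub>R d \<in> C" by (auto simp: e C_iff)
  qed
  \<comment> \<open>The Fitzpatrick function dominates the pairing: otherwise \<open>(p, u)\<close>
    is monotonically related to all of \<open>M\<close>, hence lies in \<open>M\<close>, and taking
    \<open>(a, b) = (p, u)\<close> gives the bound after all.\<close>
  have fitz: "inner p u \<le> t" if "((p, u), t) \<in> C" for p u t
  proof (rule ccontr)
    assume *: "\<not> inner p u \<le> t"
    have "(p, u) \<in> M"
    proof (rule maximal)
      fix a b assume "(a, b) \<in> M"
      then show "0 \<le> inner (a - p) (b - u)"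
        using that * by (fastforce simp: C_iff inner_simps)
    qed
    then show False using that * by (fastforce simp: C_iff)
  qed
  have graph: "((a, b), inner a b) \<in> C" if "(a, b) \<in> M" for a b
    unfolding C_iff using mono[OF that] by (fastforce simp: inner_simps)
  have "M \<noteq> {}" using maximal by blast
  then have "C \<noteq> {}" using graph by fast
  have "0 \<le> t + (norm c)\<^sup>2 / 2" if "(c, t) \<in> C" for c t
  proof -
    obtain p u where c: "c = (p, u)" by fastforce
    show ?thesis
      using fitz[of p u t] that inner_ge_zero[of "p + u"]
      by (simp add: c norm_Pair power2_norm_eq_inner inner_simps inner_commute field_simps)
  qed
  from epigraph_strongly_convex_minimiser[OF \<open>closed C\<close> \<open>convex C\<close> \<open>C \<noteq> {}\<close> this]
  obtain p q s where pqs: "((p, q), s) \<in> C"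
    "\<And>c t. (c, t) \<in> C \<Longrightarrow> s + (norm (p, q))\<^sup>2 / 2 + (norm (c - (p, q)))\<^sup>2 / 2 \<le> t + (norm c)\<^sup>2 / 2"
    by (metis surj_pair)
  \<comment> \<open>Insert a graph point into the growth inequality, use \<open>fitz\<close> to
    replace \<open>s\<close> by \<open>inner p q\<close>, and complete the product.\<close>
  have key: "(norm (p + q))\<^sup>2 \<le> inner (a + q) (b + p)" if "(a, b) \<in> M" for a b
    using pqs(2)[OF graph[OF that]] fitz[OF pqs(1)]
    by (simp add: power2_norm_eq_inner inner_simps inner_commute field_simps)
  have "(- q, - p) \<in> M"
  proof (rule maximal)
    fix a b assume "(a, b) \<in> M"
    with key show "0 \<le> inner (a - - q) (b - - p)"
      by (metis diff_minus_eq_add order_trans zero_le_power2)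
  qed
  \<comment> \<open>At \<open>(- q, - p)\<close> itself the right-hand side of \<open>key\<close> is
    zero.\<close>
  moreover from key[OF this] have "p = - q"
    by (simp add: eq_neg_iff_add_eq_0)
  ultimately show thesis using that[of "- q"] by simp
qed

section \<open>Maximal monotonicity and resolvents\<close>

text \<open>Adjoining one monotonically related pair to the graph keeps it monotone, so by
  maximality the pair was already there.\<close>

lemma maximally_monotone_mem:
  assumes "maximally_monotone A" "\<And>a b. b \<in> A a \<Longrightarrow> 0 \<le> inner (b - u) (a - p)"
  shows "u \<in> A p"
proof -
  define A' where "A' = A(p := insert u (A p))"
  have "monotone_op A'"
    unfolding monotone_op_def
  proof (intro allI ballI)
    fix x y s t assume *: "s \<in> A' x" "t \<in> A' y"
    have swap: "inner (s - t) (x - y) = inner (t - s) (y - x)"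
      by (metis inner_minus_left inner_minus_right minus_diff_eq minus_minus)
    from * consider "s \<in> A x" "t \<in> A y" | "s = u" "x = p" "t \<in> A y"
      | "s \<in> A x" "t = u" "y = p" | "s = u" "x = p" "t = u" "y = p"
      unfolding A'_def by (auto split: if_splits)
    then show "0 \<le> inner (s - t) (x - y)"
    proof cases
      case 1
      then show ?thesis using assms(1) by (auto simp: maximally_monotone_def monotone_op_def)
    next
      case 2
      then show ?thesis unfolding swap using assms(2)[of t y] by simp
    next
      case 3
      then show ?thesis using assms(2)[of s x] by simp
    qed simp
  qed
  moreover have "\<forall>x. A x \<subseteq> A' x" by (auto simp: A'_def)
  ultimately have "A' = A" using assms(1) unfolding maximally_monotone_def by blast
  then show ?thesis by (metis A'_def fun_upd_same insertI1)
qed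

lemma maximally_monotoneD:
  assumes "maximally_monotone A" "u \<in> A p" "v \<in> A q"
  shows "0 \<le> inner (u - v) (p - q)"
  using assms by (auto simp: maximally_monotone_def monotone_op_def)

text \<open>Monotonicity makes the solution of the inclusion unique and Minty's theorem makes it
  exist, so the definite description denotes it.\<close>

lemma resolvent_scale_eq_iff:
  fixes A :: "'a::{real_inner, complete_space} \<Rightarrow> 'a set"
  assumes A: "maximally_monotone A" and "0 < \<gamma>"
  shows "resolvent (op_scale \<gamma> A) z = p \<longleftrightarrow> (1 / \<gamma>) *\<^sub>R (z - p) \<in> A p"
proof -
  have iff: "p \<in> op_inverse (op_add (\<lambda>x. {x}) (op_scale \<gamma> A)) z \<longleftrightarrow> (1 / \<gamma>) *\<^sub>R (z - p) \<in> A p" for p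
  proof -
    have "p \<in> op_inverse (op_add (\<lambda>x. {x}) (op_scale \<gamma> A)) z \<longleftrightarrow> (\<exists>u\<in>A p. z = p + \<gamma> *\<^sub>R u)"
      by (auto simp: op_inverse_def op_add_def op_scale_def)
    moreover have "z = p + \<gamma> *\<^sub>R u \<longleftrightarrow> u = (1 / \<gamma>) *\<^sub>R (z - p)" for u
      using \<open>0 < \<gamma>\<close> by auto
    ultimately show ?thesis by auto
  qed
  have uniq: "p = q" if "(1 / \<gamma>) *\<^sub>R (z - p) \<in> A p" "(1 / \<gamma>) *\<^sub>R (z - q) \<in> A q" for p q
  proof -
    have "0 \<le> inner ((1 / \<gamma>) *\<^sub>R (z - p) - (1 / \<gamma>) *\<^sub>R (z - q)) (p - q)"
      by (rule maximally_monotoneD[OF A that])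
    also have "\<dots> = - (norm (p - q))\<^sup>2 / \<gamma>"
      using \<open>0 < \<gamma>\<close> by (simp add: power2_norm_eq_inner inner_simps field_simps)
    finally show ?thesis using \<open>0 < \<gamma>\<close> by (simp add: divide_le_0_iff zero_le_divide_iff)
  qed
  have "\<exists>p. (1 / \<gamma>) *\<^sub>R (z - p) \<in> A p"
  proof -
    \<comment> \<open>The graph of \<open>\<gamma> A - z\<close>: a pair \<open>(p, - p)\<close> in
      it solves the inclusion.\<close>
    define M where "M = {(a, b). (1 / \<gamma>) *\<^sub>R (b + z) \<in> A a}"
    obtain p where "(p, - p) \<in> M"
    proof (rule minty)
      fix a b c d assume "(a, b) \<in> M" "(c, d) \<in> M"
      then have "0 \<le> inner ((1 / \<gamma>) *\<^sub>R (b + z) - (1 / \<gamma>) *\<^sub>R (d + z)) (a - c)"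
        using A by (auto simp: M_def intro: maximally_monotoneD)
      also have "\<dots> = inner (a - c) (b - d) / \<gamma>"
        by (simp add: inner_simps inner_commute diff_divide_distrib add_divide_distrib)
      finally show "0 \<le> inner (a - c) (b - d)"
        using \<open>0 < \<gamma>\<close> by (simp add: zero_le_divide_iff)
    next
      fix p u assume *: "\<And>a b. (a, b) \<in> M \<Longrightarrow> 0 \<le> inner (a - p) (b - u)"
      have "(1 / \<gamma>) *\<^sub>R (u + z) \<in> A p"
      proof (rule maximally_monotone_mem[OF A])
        fix a b assume "b \<in> A a"
        then have "(a, \<gamma> *\<^sub>R b - z) \<in> M" using \<open>0 < \<gamma>\<close> by (simp add: M_def)
        then have "0 \<le> inner (a - p) (\<gamma> *\<^sub>R b - z - u) / \<gamma>"
          using * \<open>0 < \<gamma>\<close> by simp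
        also have "\<dots> = inner (b - (1 / \<gamma>) *\<^sub>R (u + z)) (a - p)"
          using \<open>0 < \<gamma>\<close>
          by (simp add: inner_simps inner_commute diff_divide_distrib add_divide_distrib)
        finally show "0 \<le> inner (b - (1 / \<gamma>) *\<^sub>R (u + z)) (a - p)" .
      qed
      then show "(p, u) \<in> M" by (simp add: M_def)
    qed
    then show ?thesis by (auto simp: M_def)
  qed
  then show ?thesis
    unfolding resolvent_def iff using uniq by (metis (mono_tags, lifting) the_equality)
qed

section \<open>Weak convergence along filters\<close>

definition weak_tendsto :: "('b \<Rightarrow> 'a::real_inner) \<Rightarrow> 'a \<Rightarrow> 'b filter \<Rightarrow> bool" where
  "weak_tendsto u l F \<longleftrightarrow> (\<forall>v. ((\<lambda>k. inner (u k) v) \<longlongrightarrow> inner l v) F)"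

lemma weak_tendstoD: "weak_tendsto u l F \<Longrightarrow> ((\<lambda>k. inner (u k) v) \<longlongrightarrow> inner l v) F"
  by (simp add: weak_tendsto_def)

lemma weak_tendsto_mono: "weak_tendsto u l F \<Longrightarrow> G \<le> F \<Longrightarrow> weak_tendsto u l G"
  unfolding weak_tendsto_def using tendsto_mono by blast

lemma tendsto_imp_weak_tendsto: "(u \<longlongrightarrow> l) F \<Longrightarrow> weak_tendsto u l F"
  unfolding weak_tendsto_def by (intro allI tendsto_intros)

lemma weak_tendsto_diff:
  "weak_tendsto u l F \<Longrightarrow> weak_tendsto v m F \<Longrightarrow> weak_tendsto (\<lambda>k. u k - v k) (l - m) F"
  unfolding weak_tendsto_def by (auto simp: inner_diff_left intro: tendsto_diff)

lemma weak_tendsto_scaleR: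
  "(c \<longlongrightarrow> r) F \<Longrightarrow> weak_tendsto u l F \<Longrightarrow> weak_tendsto (\<lambda>k. c k *\<^sub>R u k) (r *\<^sub>R l) F"
  unfolding weak_tendsto_def by (auto intro: tendsto_mult)

text \<open>Split off \<open>inner (u k) s0\<close>, which converges weakly; boundedness controls
  the rest. It is a separate assumption because weak convergence along a filter does not supply
  it.\<close>

lemma tendsto_inner_weak_tendsto:
  assumes u: "weak_tendsto u l F" "bounded (range u)" and s: "(s \<longlongrightarrow> s0) F"
  shows "((\<lambda>k. inner (u k) (s k)) \<longlongrightarrow> inner l s0) F"
proof -
  obtain M where M: "\<And>k. norm (u k) \<le> M"
    using u(2) by (auto simp: bounded_iff)
  have "((\<lambda>k. M * norm (s k - s0)) \<longlongrightarrow> M * norm (s0 - s0)) F"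
    by (intro tendsto_intros s)
  then have bound: "((\<lambda>k. M * norm (s k - s0)) \<longlongrightarrow> 0) F" by simp
  have "((\<lambda>k. inner (u k) (s k - s0)) \<longlongrightarrow> 0) F"
  proof (rule Lim_null_comparison[OF _ bound])
    show "\<forall>\<^sub>F k in F. norm (inner (u k) (s k - s0)) \<le> M * norm (s k - s0)"
      using order_trans[OF Cauchy_Schwarz_ineq2 mult_right_mono[OF M norm_ge_zero]]
      by (intro always_eventually) simp
  qed
  from tendsto_add[OF this weak_tendstoD[OF u(1), of s0]] show ?thesis
    by (simp add: inner_diff_right)
qed

text \<open>By Tychonoff, the functionals \<open>inner (u k)\<close> accumulate in the product topology; the limit is
  linear, hence represented by a vector.\<close>

lemma bounded_imp_weak_cluster_point:
  fixes u :: "'b \<Rightarrow> 'a::{real_inner, complete_space}"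
  assumes "bounded (range u)" "F \<noteq> bot"
  obtains G l where "G \<le> F" "G \<noteq> bot" "weak_tendsto u l G"
proof -
  obtain M where M: "\<And>k. norm (u k) \<le> M"
    using assms(1) by (auto simp: bounded_iff)
  define \<phi> where "\<phi> k v = inner (u k) v" for k v
  define K where "K = PiE UNIV (\<lambda>v::'a. {- (M * norm v)..M * norm v})"
  have \<phi>_le: "\<bar>\<phi> k v\<bar> \<le> M * norm v" for k v
    unfolding \<phi>_def using M[of k] Cauchy_Schwarz_ineq2[of "u k" v]
    by (meson mult_right_mono norm_ge_zero order_trans)
  have "compactin (product_topology (\<lambda>v::'a. euclideanreal) UNIV) K"
    unfolding K_def by (subst compactin_PiE) auto
  then have "compact K" by (simp add: euclidean_product_topology)
  moreover have "eventually (\<lambda>f. f \<in> K) (filtermap \<phi> F)"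
    unfolding eventually_filtermap K_def
    using \<phi>_le by (intro always_eventually) (auto simp: abs_le_iff minus_le_iff)
  ultimately obtain L where "L \<in> K" and L: "inf (nhds L) (filtermap \<phi> F) \<noteq> bot"
    using assms(2) unfolding compact_filter by (metis filtermap_bot_iff)
  \<comment> \<open>The cluster filter lives on functionals; pulling it back to the indices gives a
    filter finer than \<open>F\<close> along which \<open>\<phi>\<close> tends to
    \<open>L\<close>.\<close>
  define G where "G = inf (filtercomap \<phi> (nhds L)) F"
  have "G \<noteq> bot"
  proof
    assume "G = bot"
    then obtain Q R where QR: "eventually Q (filtercomap \<phi> (nhds L))" "eventually R F" "\<And>k. \<not> (Q k \<and> R k)"
      unfolding G_def trivial_limit_def eventually_inf by blast
    then obtain P where P: "eventually P (nhds L)" "\<And>k. P (\<phi> k) \<Longrightarrow> Q k"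
      unfolding eventually_filtercomap by blast
    have "eventually (\<lambda>f. \<not> P f) (filtermap \<phi> F)"
      unfolding eventually_filtermap using QR(2) by eventually_elim (use QR P in blast)
    then have "eventually (\<lambda>_. False) (inf (nhds L) (filtermap \<phi> F))"
      using P(1) unfolding eventually_inf by blast
    then show False using L by (simp add: trivial_limit_def)
  qed
  have "filterlim \<phi> (nhds L) G"
    by (simp add: G_def filterlim_iff_le_filtercomap)
  moreover have "((\<lambda>f. f v) \<longlongrightarrow> L v) (nhds L)" for v
  proof (rule topological_tendstoI)
    fix S assume "open S" "L v \<in> S"
    then have "open ((\<lambda>f. f v) -` S)"
      using continuous_on_product_coordinates[of v] open_vimage by blast
    with \<open>L v \<in> S\<close> show "\<forall>\<^sub>F f in nhds L. f v \<in> S"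
      unfolding eventually_nhds by (metis vimageD vimageI)
  qed
  ultimately have lim: "((\<lambda>k. inner (u k) v) \<longlongrightarrow> L v) G" for v
    using filterlim_compose[of "\<lambda>f. f v" "nhds (L v)" "nhds L" \<phi> G] unfolding \<phi>_def by simp
  have "bounded_linear L"
  proof (rule bounded_linear_intro)
    fix v w
    have "((\<lambda>k. inner (u k) (v + w)) \<longlongrightarrow> L v + L w) G"
      unfolding inner_add_right by (intro tendsto_add lim)
    then show "L (v + w) = L v + L w" using lim \<open>G \<noteq> bot\<close> tendsto_unique by blast
  next
    fix r v
    have "((\<lambda>k. inner (u k) (r *\<^sub>R v)) \<longlongrightarrow> r *\<^sub>R L v) G"
      unfolding inner_scaleR_right real_scaleR_def by (intro tendsto_mult tendsto_const lim)
    then show "L (r *\<^sub>R v) = r *\<^sub>R L v" using lim \<open>G \<noteq> bot\<close> tendsto_unique by blast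
  next
    fix v
    have "L v \<in> {- (M * norm v)..M * norm v}" using \<open>L \<in> K\<close> by (auto simp: K_def)
    then show "norm (L v) \<le> norm v * M" by (auto simp: mult.commute abs_le_iff)
  qed
  then obtain l where "\<And>v. L v = inner l v" using riesz_representation by blast
  then have "weak_tendsto u l G" using lim by (simp add: weak_tendsto_def)
  then show thesis using that \<open>G \<noteq> bot\<close> by (metis G_def inf_le2)
qed

text \<open>If convergence failed for some \<open>v\<close>, restricting \<open>F\<close> to the bad
  indices would leave a proper filter. By weak compactness it has a cluster point, which must be
  \<open>l\<close>, a contradiction.\<close>

lemma weak_tendsto_if_unique_cluster_point:
  fixes u :: "'b \<Rightarrow> 'a::{real_inner, complete_space}"
  assumes "bounded (range u)"
    and uniq: "\<And>G m. G \<le> F \<Longrightarrow> G \<noteq> bot \<Longrightarrow> weak_tendsto u m G \<Longrightarrow> m = l"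
  shows "weak_tendsto u l F"
  unfolding weak_tendsto_def
proof (intro allI tendstoI, rule ccontr)
  fix v and e :: real
  assume "0 < e" and nev: "\<not> (\<forall>\<^sub>F k in F. dist (inner (u k) v) (inner l v) < e)"
  define P where "P = principal {k. \<not> dist (inner (u k) v) (inner l v) < e}"
  have "inf F P \<noteq> bot"
    using nev by (simp add: trivial_limit_def P_def eventually_inf_principal)
  then obtain G m where G: "G \<le> inf F P" "G \<noteq> bot" "weak_tendsto u m G"
    using bounded_imp_weak_cluster_point[OF assms(1)] by metis
  then have "m = l" using uniq[of G m] by simp
  then have "\<forall>\<^sub>F k in G. dist (inner (u k) v) (inner l v) < e"
    using G(3) \<open>0 < e\<close> by (simp add: weak_tendsto_def tendstoD)
  moreover have "\<forall>\<^sub>F k in G. \<not> dist (inner (u k) v) (inner l v) < e"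
    using G(1) unfolding P_def le_inf_iff le_principal by simp
  ultimately have "\<forall>\<^sub>F k in G. False" by eventually_elim simp
  with \<open>G \<noteq> bot\<close> show False by simp
qed

text \<open>Opial's argument: \<open>(norm (u k - p))\<^sup>2 - (norm (u k - q))\<^sup>2\<close> is affine in \<open>u k\<close>.\<close>

lemma weak_cluster_points_eq:
  fixes u :: "'b \<Rightarrow> 'a::real_inner"
  assumes p: "((\<lambda>k. norm (u k - p)) \<longlongrightarrow> c) F" and q: "((\<lambda>k. norm (u k - q)) \<longlongrightarrow> d) F"
    and G: "G \<le> F" "G \<noteq> bot" "weak_tendsto u p G"
    and H: "H \<le> F" "H \<noteq> bot" "weak_tendsto u q H"
  shows "p = q"
proof -
  have "((\<lambda>k. ((norm (u k - q))\<^sup>2 - (norm (u k - p))\<^sup>2 + (norm p)\<^sup>2 - (norm q)\<^sup>2) / 2)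
    \<longlongrightarrow> (d\<^sup>2 - c\<^sup>2 + (norm p)\<^sup>2 - (norm q)\<^sup>2) / 2) F"
    by (intro tendsto_intros p q) auto
  moreover have "((norm (u k - q))\<^sup>2 - (norm (u k - p))\<^sup>2 + (norm p)\<^sup>2 - (norm q)\<^sup>2) / 2 = inner (u k) (p - q)" for k
    by (simp add: power2_norm_eq_inner inner_simps inner_commute field_simps)
  ultimately have lim: "((\<lambda>k. inner (u k) (p - q)) \<longlongrightarrow> (d\<^sup>2 - c\<^sup>2 + (norm p)\<^sup>2 - (norm q)\<^sup>2) / 2) F"
    by simp
  have "inner p (p - q) = inner q (p - q)"
    using tendsto_unique[OF G(2) weak_tendstoD[OF G(3)] tendsto_mono[OF G(1) lim]]
      tendsto_unique[OF H(2) weak_tendstoD[OF H(3)] tendsto_mono[OF H(1) lim]] by simp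
  then show ?thesis by (metis eq_iff_diff_eq_0 inner_diff_left inner_eq_zero_iff)
qed

section \<open>One step of the iteration\<close>

text \<open>Dividing \<open>d\<close> by the partial products of \<open>1 + \<epsilon> i\<close>
  gives a decreasing sequence, and summability makes these products converge, so \<open>d\<close>
  converges too.\<close>

lemma quasi_fejer:
  fixes d s \<epsilon> :: "nat \<Rightarrow> real"
  assumes d: "\<And>k. 0 \<le> d k" and s: "\<And>k. 0 \<le> s k" and \<epsilon>: "\<And>k. 0 \<le> \<epsilon> k" "summable \<epsilon>"
    and step: "\<And>k. d (Suc k) \<le> (1 + \<epsilon> k) * (d k - s k)"
  shows "convergent d" "s \<longlonglongrightarrow> 0"
proof -
  define P where "P k = (\<Prod>i<k. 1 + \<epsilon> i)" for k
  have P_pos: "0 < P k" for k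
    unfolding P_def using \<epsilon>(1) by (intro prod_pos) (simp add: add_pos_nonneg)
  have P_Suc: "P (Suc k) = (1 + \<epsilon> k) * P k" for k by (simp add: P_def)
  have "P k \<le> exp (suminf \<epsilon>)" for k
  proof -
    have "P k \<le> (\<Prod>i<k. exp (\<epsilon> i))"
      unfolding P_def using \<epsilon>(1) by (intro prod_mono) (auto simp: add_nonneg_nonneg exp_ge_add_one_self)
    also have "\<dots> = exp (\<Sum>i<k. \<epsilon> i)" by (simp add: exp_sum)
    also have "\<dots> \<le> exp (suminf \<epsilon>)" using \<epsilon> by (simp add: sum_le_suminf)
    finally show ?thesis .
  qed
  moreover have "incseq P"
    using \<epsilon>(1) P_pos by (intro incseq_SucI) (simp add: P_Suc distrib_right less_imp_le)
  ultimately have "convergent P"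
    using P_pos by (intro Bseq_monoseq_convergent BseqI'[of _ "exp (suminf \<epsilon>)"] incseq_imp_monoseq)
      (auto simp: less_imp_le)
  have drop: "d (Suc k) / P (Suc k) \<le> d k / P k - s k / P k" for k
  proof -
    have "d (Suc k) / P (Suc k) \<le> ((1 + \<epsilon> k) * (d k - s k)) / P (Suc k)"
      using step P_pos by (simp add: divide_right_mono less_imp_le)
    also have "\<dots> = d k / P k - s k / P k"
      using \<epsilon>(1)[of k] by (simp add: P_Suc diff_divide_distrib)
    finally show ?thesis .
  qed
  have "decseq (\<lambda>k. d k / P k)"
    using drop s P_pos by (intro decseq_SucI) (smt (verit) divide_nonneg_pos)
  then have "convergent (\<lambda>k. d k / P k)"
    using decseq_convergent[of "\<lambda>k. d k / P k" 0] d P_pos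
    by (metis convergentI divide_nonneg_pos)
  then have "convergent (\<lambda>k. d k / P k * P k)"
    using \<open>convergent P\<close> by (rule convergent_mult)
  then show "convergent d" using P_pos by (simp add: less_imp_neq[symmetric])
  then obtain D where D: "d \<longlonglongrightarrow> D" by (auto simp: convergent_def)
  \<comment> \<open>Solving the step inequality for \<open>s k\<close> squeezes it between 0 and a
    difference whose two terms share a limit.\<close>
  have s_le: "s k \<le> d k - d (Suc k) / (1 + \<epsilon> k)" for k
    using step[of k] \<epsilon>(1)[of k] by (simp add: field_simps)
  have "(\<lambda>k. d k - d (Suc k) / (1 + \<epsilon> k)) \<longlonglongrightarrow> D - D / (1 + 0)"
    by (intro tendsto_intros D LIMSEQ_Suc summable_LIMSEQ_zero[OF \<epsilon>(2)]) simp
  then show "s \<longlonglongrightarrow> 0"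
    using s s_le by (intro tendsto_sandwich[of "\<lambda>_. 0" s _ "\<lambda>k. d k - d (Suc k) / (1 + \<epsilon> k)"]) auto
qed

text \<open>The primed data describe a zero. Add the monotonicity inequalities of both operators and
  cocoercivity, each scaled by \<open>\<gamma>\<close>, after eliminating \<open>b\<close> through
  \<open>b_eq\<close> and \<open>b'\<close> through \<open>zero\<close>. The right-hand side pairs
  the residual with the offset from the fixed point.\<close>

lemma forward_backward_step:
  fixes x y a b c x' a' b' c' :: "'a::real_inner"
  assumes "0 < \<gamma>"
    and a: "0 \<le> inner (a - a') (x - x')" and b: "0 \<le> inner (b - b') (y - x')"
    and c: "1 / \<beta> * (norm (c - c'))\<^sup>2 \<le> inner (c - c') (x - x')"
    and zero: "a' + b' + c' = 0"
    and b_eq: "\<gamma> *\<^sub>R (a + b + c) = x - y"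
  shows "(norm (x - y))\<^sup>2 + \<gamma> / \<beta> * (norm (c - c'))\<^sup>2 - \<gamma> * inner (c - c') (x - y)
    \<le> inner (x - y) ((x + \<gamma> *\<^sub>R a) - (x' + \<gamma> *\<^sub>R a'))"
proof -
  define u p q r where "u = x - y" and "p = x - x'" and "q = a - a'" and "r = c - c'"
  have "\<gamma> *\<^sub>R (b - b') = \<gamma> *\<^sub>R (a + b + c) - \<gamma> *\<^sub>R (a' + b' + c') - \<gamma> *\<^sub>R q - \<gamma> *\<^sub>R r"
    by (simp add: q_def r_def algebra_simps)
  then have *: "\<gamma> *\<^sub>R (b - b') = u - \<gamma> *\<^sub>R q - \<gamma> *\<^sub>R r"
    by (simp add: zero b_eq u_def)
  have yx: "y - x' = p - u" by (simp add: p_def u_def)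
  have "0 \<le> \<gamma> * inner (b - b') (y - x')" using b \<open>0 < \<gamma>\<close> by simp
  also have "\<dots> = inner (u - \<gamma> *\<^sub>R q - \<gamma> *\<^sub>R r) (p - u)"
    unfolding *[symmetric] yx by simp
  finally have 1: "0 \<le> inner (u - \<gamma> *\<^sub>R q - \<gamma> *\<^sub>R r) (p - u)" .
  have 2: "0 \<le> \<gamma> * inner q p" using a \<open>0 < \<gamma>\<close> by (simp add: p_def q_def)
  have 3: "\<gamma> / \<beta> * (norm r)\<^sup>2 \<le> \<gamma> * inner r p"
    using mult_left_mono[OF c, of \<gamma>] \<open>0 < \<gamma>\<close> by (simp add: p_def r_def)
  have zz: "(x + \<gamma> *\<^sub>R a) - (x' + \<gamma> *\<^sub>R a') = p + \<gamma> *\<^sub>R q"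
    by (simp add: p_def q_def algebra_simps)
  have "(norm u)\<^sup>2 + \<gamma> / \<beta> * (norm r)\<^sup>2 - \<gamma> * inner r u \<le> inner u (p + \<gamma> *\<^sub>R q)"
    using 1 2 3 by (simp add: power2_norm_eq_inner inner_simps inner_commute right_diff_distrib)
  then show ?thesis by (simp only: zz flip: u_def r_def)
qed

text \<open>Completing the square around \<open>r = (\<beta> / 2) u\<close> removes the forward term
  at the cost of \<open>\<beta> * \<gamma> / 4\<close> in the coefficient of the squared residual.
  The claim is then the expansion of the left-hand side.\<close>

lemma relaxed_step:
  fixes u v r :: "'a::real_inner"
  assumes "0 < \<beta>" "0 \<le> \<gamma>" "0 \<le> \<rho>"
    and uv: "(norm u)\<^sup>2 + \<gamma> / \<beta> * (norm r)\<^sup>2 - \<gamma> * inner r u \<le> inner u v"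
  shows "(norm (v - \<rho> *\<^sub>R u))\<^sup>2 \<le> (norm v)\<^sup>2 - \<rho> * (2 - \<beta> * \<gamma> / 2 - \<rho>) * (norm u)\<^sup>2"
proof -
  have "0 \<le> \<gamma> / \<beta> * (norm (r - (\<beta> / 2) *\<^sub>R u))\<^sup>2"
    using assms by simp
  also have "\<dots> = \<gamma> / \<beta> * (norm r)\<^sup>2 - \<gamma> * inner r u + \<beta> * \<gamma> / 4 * (norm u)\<^sup>2"
    using \<open>0 < \<beta>\<close> by (simp add: power2_norm_eq_inner inner_simps inner_commute field_simps)
  finally have "(1 - \<beta> * \<gamma> / 4) * (norm u)\<^sup>2 \<le> inner u v"
    using uv by (simp add: left_diff_distrib)
  from mult_left_mono[OF this \<open>0 \<le> \<rho>\<close>] show ?thesis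
    by (simp add: power2_norm_eq_inner inner_simps inner_commute algebra_simps)
qed

lemma norm_le_norm_add_scaleR:
  fixes p q :: "'a::real_inner"
  assumes "0 \<le> inner p q" "0 \<le> \<gamma>"
  shows "norm p \<le> norm (p + \<gamma> *\<^sub>R q)"
proof (rule power2_le_imp_le)
  have "0 \<le> \<gamma> * inner p q" "0 \<le> \<gamma> * (\<gamma> * inner q q)" using assms by simp_all
  then show "(norm p)\<^sup>2 \<le> (norm (p + \<gamma> *\<^sub>R q))\<^sup>2"
    by (simp add: power2_norm_eq_inner inner_simps inner_commute)
qed simp

text \<open>Decreasing the stepsize shortens the vector. When it increases, the new vector plus a
  nonnegative multiple of \<open>p\<close> is the old one times \<open>\<gamma>' / \<gamma>\<close>.
  So only increases of the stepsize cost anything.\<close>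

lemma norm_rescale_le:
  fixes p q :: "'a::real_inner"
  assumes "0 \<le> inner p q" "0 < \<gamma>" "0 < \<gamma>'"
  shows "(norm (p + \<gamma>' *\<^sub>R q))\<^sup>2 \<le> max 1 ((\<gamma>' / \<gamma>)\<^sup>2) * (norm (p + \<gamma> *\<^sub>R q))\<^sup>2"
proof (cases "\<gamma>' \<le> \<gamma>")
  case True
  have "0 \<le> inner (p + \<gamma>' *\<^sub>R q) q"
    using assms by (simp add: inner_simps)
  from norm_le_norm_add_scaleR[OF this, of "\<gamma> - \<gamma>'"] True
  have "norm (p + \<gamma>' *\<^sub>R q) \<le> norm (p + \<gamma> *\<^sub>R q)" by (simp add: algebra_simps)
  then have "(norm (p + \<gamma>' *\<^sub>R q))\<^sup>2 \<le> 1 * (norm (p + \<gamma> *\<^sub>R q))\<^sup>2"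
    by (simp add: power_mono)
  also have "\<dots> \<le> max 1 ((\<gamma>' / \<gamma>)\<^sup>2) * (norm (p + \<gamma> *\<^sub>R q))\<^sup>2"
    by (intro mult_right_mono) auto
  finally show ?thesis .
next
  case False
  have "0 \<le> inner (p + \<gamma>' *\<^sub>R q) p"
    using assms by (simp add: inner_simps inner_commute)
  from norm_le_norm_add_scaleR[OF this, of "\<gamma>' / \<gamma> - 1"] False assms
  have "norm (p + \<gamma>' *\<^sub>R q) \<le> norm ((\<gamma>' / \<gamma>) *\<^sub>R (p + \<gamma> *\<^sub>R q))"
    by (simp add: algebra_simps)
  also have "\<dots> = \<gamma>' / \<gamma> * norm (p + \<gamma> *\<^sub>R q)" using assms by simp
  finally have "(norm (p + \<gamma>' *\<^sub>R q))\<^sup>2 \<le> (\<gamma>' / \<gamma> * norm (p + \<gamma> *\<^sub>R q))\<^sup>2"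
    by (simp add: power_mono)
  also have "\<dots> \<le> max 1 ((\<gamma>' / \<gamma>)\<^sup>2) * (norm (p + \<gamma> *\<^sub>R q))\<^sup>2"
    unfolding power_mult_distrib by (intro mult_right_mono) auto
  finally show ?thesis .
qed

text \<open>Only the limit of the sum of the two pairings is available, not of each one separately.\<close>

lemma demiclosed_pair:
  fixes x y a b :: "'b \<Rightarrow> 'a::real_inner"
  assumes A1: "maximally_monotone A1" "\<And>k. a k \<in> A1 (x k)"
    and A2: "maximally_monotone A2" "\<And>k. b k \<in> A2 (y k)"
    and weak: "weak_tendsto x xh F" "weak_tendsto y xh F" "weak_tendsto a ah F" "weak_tendsto b bh F"
    and pairing: "((\<lambda>k. inner (a k) (x k) + inner (b k) (y k)) \<longlongrightarrow> inner (ah + bh) xh) F"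
    and "F \<noteq> bot"
  shows "ah \<in> A1 xh" "bh \<in> A2 xh"
proof -
  \<comment> \<open>Limit of the sum of the two monotonicity inequalities, tested against arbitrary
    graph points.\<close>
  have key: "0 \<le> inner (ah - u) (xh - p) + inner (bh - v) (xh - q)" if "u \<in> A1 p" "v \<in> A2 q" for u p v q
  proof (rule tendsto_lowerbound)
    have "((\<lambda>k. (inner (a k) (x k) + inner (b k) (y k)) - inner (a k) p - inner (x k) u + inner u p
        - inner (b k) q - inner (y k) v + inner v q)
      \<longlongrightarrow> inner (ah + bh) xh - inner ah p - inner xh u + inner u p - inner bh q - inner xh v + inner v q) F"
      by (intro tendsto_add tendsto_diff tendsto_const pairing weak_tendstoD weak)
    then show "((\<lambda>k. inner (a k - u) (x k - p) + inner (b k - v) (y k - q))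
      \<longlongrightarrow> inner (ah - u) (xh - p) + inner (bh - v) (xh - q)) F"
      by (simp add: inner_simps inner_commute algebra_simps)
    show "\<forall>\<^sub>F k in F. 0 \<le> inner (a k - u) (x k - p) + inner (b k - v) (y k - q)"
      using A1 A2 that by (intro always_eventually allI add_nonneg_nonneg maximally_monotoneD)
  qed fact
  \<comment> \<open>A graph point of \<open>A1\<close> violating monotonicity makes the first term
    of \<open>key\<close> negative, so the second is positive for every graph point of
    \<open>A2\<close>. Hence \<open>bh\<close> lies in \<open>A2 xh\<close>, and testing with that
    very pair makes the second term zero.\<close>
  show "ah \<in> A1 xh"
  proof (rule ccontr)
    assume "ah \<notin> A1 xh"
    then obtain u p where up: "u \<in> A1 p" "inner (u - ah) (p - xh) < 0"
      using maximally_monotone_mem[OF A1(1)] by (metis not_le)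
    then have neg: "inner (ah - u) (xh - p) < 0"
      by (metis inner_minus_left inner_minus_right minus_diff_eq minus_minus)
    have "bh \<in> A2 xh"
    proof (rule maximally_monotone_mem[OF A2(1)])
      fix q v assume "v \<in> A2 q"
      then have "0 \<le> inner (bh - v) (xh - q)" using key[OF up(1)] neg by fastforce
      then show "0 \<le> inner (v - bh) (q - xh)"
        by (metis inner_minus_left inner_minus_right minus_diff_eq minus_minus)
    qed
    from key[OF up(1) this] neg show False by simp
  qed
  show "bh \<in> A2 xh"
  proof (rule maximally_monotone_mem[OF A2(1)])
    fix q v assume "v \<in> A2 q"
    from key[OF \<open>ah \<in> A1 xh\<close> this] show "0 \<le> inner (v - bh) (q - xh)"
      by (simp add: inner_simps)
  qed
qed

section \<open>Convergence of the iteration\<close>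

text \<open>The resolvents are replaced by graph inclusions, and \<open>\<rho> k\<close> stands for
  \<open>lam k * \<theta> k\<close>. The equations \<open>z_eq\<close> and \<open>w_eq'\<close> use
  the same \<open>a (Suc k)\<close> with two stepsizes, which encodes the correction step.\<close>

locale davis_yin_iteration =
  fixes A1 A2 :: "'a::{real_inner, complete_space} \<Rightarrow> 'a set" and B :: "'a \<Rightarrow> 'a"
    and \<beta> \<gamma>bar m c :: real and \<gamma> \<rho> :: "nat \<Rightarrow> real" and x y z w a b :: "nat \<Rightarrow> 'a"
  assumes A1: "maximally_monotone A1" and A2: "maximally_monotone A2"
    and \<beta>: "0 < \<beta>" and B: "cocoercive \<beta> B"
    and m: "0 < m" "\<And>k. m \<le> \<gamma> k" and \<gamma>_less: "\<And>k. \<gamma> k < 2 / \<beta>"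
    and \<gamma>_lim: "\<gamma> \<longlonglongrightarrow> \<gamma>bar" and \<gamma>_sum: "summable (\<lambda>k. max (\<gamma> (Suc k) - \<gamma> k) 0)"
    and c: "0 < c" "\<And>k. c \<le> \<rho> k" and \<rho>_le: "\<forall>\<^sub>F k in sequentially. \<rho> k \<le> 1 - \<beta> * \<gamma> k / 2"
    and a: "\<And>k. a k \<in> A1 (x k)" and b: "\<And>k. b k \<in> A2 (y k)"
    and z_eq: "\<And>k. z k = x k + \<gamma> k *\<^sub>R a k"
    and b_eq: "\<And>k. \<gamma> k *\<^sub>R (a k + b k + B (x k)) = x k - y k"
    and w_eq: "\<And>k. w k = z k - \<rho> k *\<^sub>R (x k - y k)"
    and w_eq': "\<And>k. w k = x (Suc k) + \<gamma> k *\<^sub>R a (Suc k)"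
begin

lemma \<gamma>_pos: "0 < \<gamma> k"
  using m(1) m(2)[of k] by linarith

lemma \<gamma>bar_pos: "0 < \<gamma>bar"
  using LIMSEQ_le_const[OF \<gamma>_lim, of m] m by fastforce

lemma B_cocoercive: "1 / \<beta> * (norm (B p - B q))\<^sup>2 \<le> inner (B p - B q) (p - q)"
  using B unfolding cocoercive_def by blast

lemma B_lipschitz: "norm (B p - B q) \<le> \<beta> * norm (p - q)"
proof (cases "B p = B q")
  case False
  have "1 / \<beta> * (norm (B p - B q))\<^sup>2 \<le> norm (B p - B q) * norm (p - q)"
    using B_cocoercive norm_cauchy_schwarz order_trans by blast
  then have "norm (B p - B q) * norm (B p - B q) \<le> norm (B p - B q) * (\<beta> * norm (p - q))"
    using \<beta> by (simp add: field_simps power2_eq_square)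
  then show ?thesis using False by simp
qed (use \<beta> in simp)

text \<open>A primal-dual solution: \<open>u\<close> certifies that \<open>p\<close> is a zero, and
  \<open>p + \<gamma> u\<close> is the associated fixed point for stepsize
  \<open>\<gamma>\<close>.\<close>

definition zero_pair :: "'a \<Rightarrow> 'a \<Rightarrow> bool" where
  "zero_pair p u \<longleftrightarrow> u \<in> A1 p \<and> - u - B p \<in> A2 p"

lemma zero_pairE:
  assumes "p \<in> zer (op_add (op_add A1 A2) (\<lambda>x. {B x}))"
  obtains u where "zero_pair p u"
proof -
  from assms obtain u v where "u \<in> A1 p" "v \<in> A2 p" "0 = u + v + B p"
    by (auto simp: zer_def op_add_def)
  moreover from this have "v = - u - B p" by (simp add: algebra_simps eq_neg_iff_add_eq_0)
  ultimately show thesis using that by (simp add: zero_pair_def)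
qed

lemma zero_pair_zer: "zero_pair p u \<Longrightarrow> p \<in> zer (op_add (op_add A1 A2) (\<lambda>x. {B x}))"
  unfolding zero_pair_def zer_def op_add_def by force

text \<open>The constant bounds
  \<open>(\<gamma> (Suc k) + \<gamma> k) / (\<gamma> k)\<^sup>2\<close>, the factor that turns an
  increment of the stepsize into that of the squared ratio.\<close>

definition \<epsilon> :: "nat \<Rightarrow> real" where
  "\<epsilon> k = max (\<gamma> (Suc k) - \<gamma> k) 0 * (4 / \<beta> / m\<^sup>2)"

lemma \<epsilon>_nonneg: "0 \<le> \<epsilon> k"
  unfolding \<epsilon>_def using \<beta> by (intro mult_nonneg_nonneg) auto

lemma summable_\<epsilon>: "summable \<epsilon>"
  unfolding \<epsilon>_def by (intro summable_mult2 \<gamma>_sum)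

lemma rescale_factor_le: "max 1 ((\<gamma> (Suc k) / \<gamma> k)\<^sup>2) \<le> 1 + \<epsilon> k"
proof (cases "\<gamma> (Suc k) \<le> \<gamma> k")
  case True
  then have "(\<gamma> (Suc k) / \<gamma> k)\<^sup>2 \<le> 1"
    using \<gamma>_pos by (intro power_le_one) (auto simp: less_imp_le)
  then show ?thesis using \<epsilon>_nonneg[of k] by simp
next
  case False
  have "(\<gamma> (Suc k) / \<gamma> k)\<^sup>2 - 1 = (\<gamma> (Suc k) - \<gamma> k) * ((\<gamma> (Suc k) + \<gamma> k) / (\<gamma> k)\<^sup>2)"
    using \<gamma>_pos[of k] by (simp add: field_simps power2_eq_square)
  also have "\<dots> \<le> (\<gamma> (Suc k) - \<gamma> k) * (4 / \<beta> / m\<^sup>2)"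
  proof (intro mult_left_mono frac_le)
    show "\<gamma> (Suc k) + \<gamma> k \<le> 4 / \<beta>" using \<gamma>_less[of k] \<gamma>_less[of "Suc k"] by linarith
    show "m\<^sup>2 \<le> (\<gamma> k)\<^sup>2" using m by (intro power_mono) auto
  qed (use False m \<beta> in auto)
  finally show ?thesis using False \<epsilon>_nonneg[of k] by (simp add: \<epsilon>_def)
qed

section \<open>Estimates relative to a fixed zero\<close>

context
  fixes p u :: 'a
  assumes pu: "zero_pair p u"
begin

definition d :: "nat \<Rightarrow> real" where
  "d k = (norm (z k - (p + \<gamma> k *\<^sub>R u)))\<^sup>2"

lemma A1_pair_nonneg: "0 \<le> inner (a k - u) (x k - p)"
  using pu a A1 by (auto simp: zero_pair_def intro: maximally_monotoneD)

lemma step_inner_le: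
  "(norm (x k - y k))\<^sup>2 + \<gamma> k / \<beta> * (norm (B (x k) - B p))\<^sup>2 - \<gamma> k * inner (B (x k) - B p) (x k - y k)
    \<le> inner (x k - y k) (z k - (p + \<gamma> k *\<^sub>R u))"
  unfolding z_eq
proof (rule forward_backward_step)
  show "0 \<le> inner (b k - (- u - B p)) (y k - p)"
    using pu b A2 by (intro maximally_monotoneD[of A2]) (auto simp: zero_pair_def)
qed (use \<gamma>_pos A1_pair_nonneg B_cocoercive b_eq in auto)

lemma fejer_step: "d (Suc k) \<le> (1 + \<epsilon> k) * (d k - \<rho> k * (2 - \<beta> * \<gamma> k / 2 - \<rho> k) * (norm (x k - y k))\<^sup>2)"
proof -
  have "d (Suc k) = (norm ((x (Suc k) - p) + \<gamma> (Suc k) *\<^sub>R (a (Suc k) - u)))\<^sup>2"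
    by (simp add: d_def z_eq algebra_simps)
  \<comment> \<open>Replaces the stepsize \<open>\<gamma> (Suc k)\<close> by
    \<open>\<gamma> k\<close>, which passes from \<open>z (Suc k)\<close> to \<open>w k\<close>;
    monotonicity of \<open>A1\<close> supplies the sign condition.\<close>
  also have "\<dots> \<le> max 1 ((\<gamma> (Suc k) / \<gamma> k)\<^sup>2) * (norm ((x (Suc k) - p) + \<gamma> k *\<^sub>R (a (Suc k) - u)))\<^sup>2"
    using A1_pair_nonneg[of "Suc k"] \<gamma>_pos by (intro norm_rescale_le) (auto simp: inner_commute)
  also have "\<dots> = max 1 ((\<gamma> (Suc k) / \<gamma> k)\<^sup>2) * (norm (w k - (p + \<gamma> k *\<^sub>R u)))\<^sup>2"
    by (simp add: w_eq' algebra_simps)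
  also have "\<dots> \<le> (1 + \<epsilon> k) * (norm (w k - (p + \<gamma> k *\<^sub>R u)))\<^sup>2"
    by (intro mult_right_mono rescale_factor_le) simp
  also have "w k - (p + \<gamma> k *\<^sub>R u) = (z k - (p + \<gamma> k *\<^sub>R u)) - \<rho> k *\<^sub>R (x k - y k)"
    by (simp add: w_eq)
  also have "(1 + \<epsilon> k) * (norm \<dots>)\<^sup>2 \<le> (1 + \<epsilon> k) * (d k - \<rho> k * (2 - \<beta> * \<gamma> k / 2 - \<rho> k) * (norm (x k - y k))\<^sup>2)"
    unfolding d_def
  proof (intro mult_left_mono relaxed_step[where r = "B (x k) - B p"] step_inner_le)
    show "0 \<le> \<rho> k" using c(1) c(2)[of k] by linarith
  qed (use \<beta> \<gamma>_pos[of k] \<epsilon>_nonneg[of k] in auto)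
  finally show ?thesis .
qed

lemma convergent_d: "convergent d"
  and residual_tendsto_0: "(\<lambda>k. x k - y k) \<longlonglongrightarrow> 0"
proof -
  obtain N where N: "\<And>k. k \<ge> N \<Longrightarrow> \<rho> k \<le> 1 - \<beta> * \<gamma> k / 2"
    using \<rho>_le by (auto simp: eventually_sequentially)
  have step: "d (Suc (k + N)) \<le> (1 + \<epsilon> (k + N)) * (d (k + N) - c * (norm (x (k + N) - y (k + N)))\<^sup>2)" for k
  proof -
    \<comment> \<open>Beyond \<open>N\<close> the bound on \<open>\<rho>\<close> makes the bracket
      at least 1.\<close>
    have "c * 1 \<le> \<rho> (k + N) * (2 - \<beta> * \<gamma> (k + N) / 2 - \<rho> (k + N))"
      using c(1) c(2)[of "k + N"] N[of "k + N"] by (intro mult_mono) auto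
    then have "c * (norm (x (k + N) - y (k + N)))\<^sup>2 
      \<le> \<rho> (k + N) * (2 - \<beta> * \<gamma> (k + N) / 2 - \<rho> (k + N)) * (norm (x (k + N) - y (k + N)))\<^sup>2"
      by (intro mult_right_mono) auto
    then have "(1 + \<epsilon> (k + N)) * (d (k + N) - \<rho> (k + N) * (2 - \<beta> * \<gamma> (k + N) / 2 - \<rho> (k + N)) * (norm (x (k + N) - y (k + N)))\<^sup>2)
      \<le> (1 + \<epsilon> (k + N)) * (d (k + N) - c * (norm (x (k + N) - y (k + N)))\<^sup>2)"
      using \<epsilon>_nonneg[of "k + N"] by (intro mult_left_mono) auto
    with fejer_step[of "k + N"] show ?thesis by linarith
  qed
  have qf: "convergent (\<lambda>k. d (k + N))" "(\<lambda>k. c * (norm (x (k + N) - y (k + N)))\<^sup>2) \<longlonglongrightarrow> 0"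
    using quasi_fejer[of "\<lambda>k. d (k + N)" "\<lambda>k. c * (norm (x (k + N) - y (k + N)))\<^sup>2" "\<lambda>k. \<epsilon> (k + N)"]
      step c(1) \<epsilon>_nonneg summable_\<epsilon>
    by (auto simp: summable_iff_shift d_def)
  show "convergent d"
    using qf(1) convergent_ignore_initial_segment by blast
  have "(\<lambda>k. c * (norm (x k - y k))\<^sup>2) \<longlonglongrightarrow> 0"
    by (rule LIMSEQ_offset[OF qf(2)])
  from tendsto_real_sqrt[OF tendsto_mult[OF tendsto_const[of "1 / c"] this]]
  have "(\<lambda>k. norm (x k - y k)) \<longlonglongrightarrow> 0" using c(1) by simp
  then show "(\<lambda>k. x k - y k) \<longlonglongrightarrow> 0" by (simp only: tendsto_norm_zero_iff)
qed

text \<open>Exchanging the moving reference point for its limit changes the distance by at most the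
  norm of \<open>(\<gamma> k - \<gamma>bar) u\<close>, which vanishes.\<close>

lemma convergent_norm_z_diff: "convergent (\<lambda>k. norm (z k - (p + \<gamma>bar *\<^sub>R u)))"
proof -
  obtain D where D: "d \<longlonglongrightarrow> D" using convergent_d by (auto simp: convergent_def)
  have 1: "(\<lambda>k. norm (z k - (p + \<gamma> k *\<^sub>R u))) \<longlonglongrightarrow> sqrt D"
    using tendsto_real_sqrt[OF D] by (simp add: d_def)
  have "(\<lambda>k. norm ((\<gamma> k - \<gamma>bar) *\<^sub>R u)) \<longlonglongrightarrow> norm ((\<gamma>bar - \<gamma>bar) *\<^sub>R u)"
    by (intro tendsto_intros \<gamma>_lim)
  then have lim0: "(\<lambda>k. norm ((\<gamma> k - \<gamma>bar) *\<^sub>R u)) \<longlonglongrightarrow> 0" by simp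
  have 2: "(\<lambda>k. norm (z k - (p + \<gamma>bar *\<^sub>R u)) - norm (z k - (p + \<gamma> k *\<^sub>R u))) \<longlonglongrightarrow> 0"
  proof (rule Lim_null_comparison[OF always_eventually lim0], rule allI)
    fix k
    have "(z k - (p + \<gamma>bar *\<^sub>R u)) - (z k - (p + \<gamma> k *\<^sub>R u)) = (\<gamma> k - \<gamma>bar) *\<^sub>R u"
      by (simp add: algebra_simps)
    then show "norm (norm (z k - (p + \<gamma>bar *\<^sub>R u)) - norm (z k - (p + \<gamma> k *\<^sub>R u))) \<le> norm ((\<gamma> k - \<gamma>bar) *\<^sub>R u)"
      by (metis norm_triangle_ineq3 real_norm_def)
  qed
  from tendsto_add[OF 2 1] show ?thesis by (auto simp: convergent_def)
qed

lemma obtain_bound: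
  obtains K where "\<And>k. norm (z k - (p + \<gamma> k *\<^sub>R u)) \<le> K" "\<And>k. norm (x k - p) \<le> K"
proof -
  have "Bseq d" using convergent_d by (rule convergent_imp_Bseq)
  then obtain M where M: "0 < M" "\<And>k. norm (d k) \<le> M" by (auto simp: Bseq_def)
  have 1: "norm (z k - (p + \<gamma> k *\<^sub>R u)) \<le> sqrt M" for k
    using M(2)[of k] by (intro real_le_rsqrt) (simp add: d_def)
  have 2: "norm (x k - p) \<le> sqrt M" for k
  proof -
    \<comment> \<open>Nonexpansiveness of the resolvent of \<open>A1\<close>, in graph form.\<close>
    have "norm (x k - p) \<le> norm ((x k - p) + \<gamma> k *\<^sub>R (a k - u))"
      using A1_pair_nonneg[of k] \<gamma>_pos[of k]
      by (intro norm_le_norm_add_scaleR) (auto simp: inner_commute less_imp_le)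
    also have "(x k - p) + \<gamma> k *\<^sub>R (a k - u) = z k - (p + \<gamma> k *\<^sub>R u)"
      by (simp add: z_eq algebra_simps)
    finally show ?thesis using 1[of k] by simp
  qed
  show thesis using that[OF 1 2] .
qed

lemma bounded_x: "bounded (range x)"
proof -
  obtain K where "\<And>k. norm (x k - p) \<le> K" using obtain_bound by blast
  then have "norm (x k) \<le> K + norm p" for k
    using norm_triangle_sub[of "x k" p] by (smt (verit))
  then show ?thesis unfolding bounded_iff by blast
qed

lemma bounded_z: "bounded (range z)"
proof -
  have "Bseq (\<lambda>k. norm (z k - (p + \<gamma>bar *\<^sub>R u)))"
    using convergent_norm_z_diff by (rule convergent_imp_Bseq)
  then obtain K where "\<And>k. norm (z k - (p + \<gamma>bar *\<^sub>R u)) \<le> K" by (auto simp: Bseq_def)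
  then have "norm (z k) \<le> K + norm (p + \<gamma>bar *\<^sub>R u)" for k
    using norm_triangle_sub[of "z k" "p + \<gamma>bar *\<^sub>R u"] by (smt (verit))
  then show ?thesis unfolding bounded_iff by blast
qed

text \<open>The cocoercivity term kept in \<open>step_inner_le\<close> is bounded by the residual
  paired with a bounded vector, and the residual tends to 0.\<close>

lemma B_x_tendsto: "(\<lambda>k. B (x k)) \<longlonglongrightarrow> B p"
proof -
  obtain K where K: "\<And>k. norm (z k - (p + \<gamma> k *\<^sub>R u)) \<le> K" "\<And>k. norm (x k - p) \<le> K"
    using obtain_bound by blast
  define r where "r k = B (x k) - B p" for k
  have r_le: "(norm (r k))\<^sup>2 \<le> \<beta> / m * (3 * K * norm (x k - y k))" for k
  proof -
    \<comment> \<open>This vector absorbs the cross term with \<open>r k\<close>. Its norm is at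
      most \<open>K\<close> plus \<open>(2 / \<beta>) * (\<beta> * K)\<close>.\<close>
    let ?v = "z k - (p + \<gamma> k *\<^sub>R u) + \<gamma> k *\<^sub>R r k"
    have "norm (r k) \<le> \<beta> * K"
      using B_lipschitz[of "x k" p] K(2)[of k] \<beta> unfolding r_def
      by (meson less_imp_le mult_left_mono order_trans)
    then have "\<gamma> k * norm (r k) \<le> 2 / \<beta> * (\<beta> * K)"
      using \<gamma>_less[of k] \<beta> by (intro mult_mono) (auto simp: less_imp_le)
    then have "norm (\<gamma> k *\<^sub>R r k) \<le> 2 * K" using \<beta> \<gamma>_pos[of k] by simp
    then have v: "norm ?v \<le> 3 * K"
      using norm_triangle_ineq[of "z k - (p + \<gamma> k *\<^sub>R u)" "\<gamma> k *\<^sub>R r k"] K(1)[of k] by linarith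
    have "m / \<beta> * (norm (r k))\<^sup>2 \<le> \<gamma> k / \<beta> * (norm (r k))\<^sup>2"
      using m(2) \<beta> by (intro mult_right_mono divide_right_mono) auto
    also have "\<dots> \<le> inner (x k - y k) ?v"
      using step_inner_le[of k, folded r_def] zero_le_power2[of "norm (x k - y k)"]
      unfolding inner_add_right inner_scaleR_right inner_commute[of "r k"] by linarith
    also have "\<dots> \<le> norm (x k - y k) * norm ?v" by (rule norm_cauchy_schwarz)
    also have "\<dots> \<le> norm (x k - y k) * (3 * K)" using v by (intro mult_left_mono) auto
    finally show ?thesis using m(1) \<beta> by (simp add: field_simps)
  qed
  have "(\<lambda>k. \<beta> / m * (3 * K * norm (x k - y k))) \<longlonglongrightarrow> \<beta> / m * (3 * K * norm (0::'a))"
    by (intro tendsto_intros residual_tendsto_0)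
  then have "(\<lambda>k. (norm (r k))\<^sup>2) \<longlonglongrightarrow> 0"
    using r_le by (intro tendsto_sandwich[of "\<lambda>_. 0" "\<lambda>k. (norm (r k))\<^sup>2" _ "\<lambda>k. \<beta> / m * (3 * K * norm (x k - y k))"]) auto
  then have "r \<longlonglongrightarrow> 0"
    using tendsto_norm_zero_iff[of r] by (simp add: power_tendsto_0_iff)
  from tendsto_add[OF this tendsto_const[of "B p"]] show ?thesis by (simp add: r_def)
qed

text \<open>Since \<open>B (x k)\<close> converges in norm, so does the sum \<open>s\<close> of the
  two graph elements. This determines the limit of the summed pairings that
  \<open>demiclosed_pair\<close> asks for.\<close>

lemma weak_cluster_point_zero_pair:
  assumes "G \<le> sequentially" "G \<noteq> bot" "weak_tendsto x xh G" "weak_tendsto z zh G"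
  shows "zero_pair xh ((1 / \<gamma>bar) *\<^sub>R (zh - xh))"
proof -
  have lims: "((\<lambda>k. x k - y k) \<longlongrightarrow> 0) G" "((\<lambda>k. B (x k)) \<longlongrightarrow> B p) G" "(\<gamma> \<longlongrightarrow> \<gamma>bar) G"
    using assms(1) residual_tendsto_0 B_x_tendsto \<gamma>_lim tendsto_mono by blast+
  have inv: "((\<lambda>k. 1 / \<gamma> k) \<longlongrightarrow> 1 / \<gamma>bar) G"
    using \<gamma>bar_pos by (intro tendsto_intros lims) simp
  define ah where "ah = (1 / \<gamma>bar) *\<^sub>R (zh - xh)"
  define s where "s k = (1 / \<gamma> k) *\<^sub>R (x k - y k) - B (x k)" for k
  have a': "a k = (1 / \<gamma> k) *\<^sub>R (z k - x k)" for k
    using \<gamma>_pos[of k] by (simp add: z_eq)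
  have "(1 / \<gamma> k) *\<^sub>R (x k - y k) = a k + b k + B (x k)" for k
    unfolding b_eq[symmetric] using \<gamma>_pos[of k] by simp
  then have ab: "a k + b k = s k" for k by (simp add: s_def)
  have s_lim: "(s \<longlongrightarrow> - B p) G"
    using tendsto_diff[OF tendsto_scaleR[OF inv lims(1)] lims(2)] unfolding s_def by simp
  \<comment> \<open>The pairing in the cocoercivity inequality at \<open>xh\<close> couples a weakly
    null factor with a norm-convergent one, so the limit forces equality.\<close>
  have Bxh: "B xh = B p"
  proof -
    have "((\<lambda>k. inner (x k - xh) (B (x k) - B xh)) \<longlongrightarrow> inner (xh - xh) (B p - B xh)) G"
      unfolding inner_diff_left
      by (intro tendsto_diff tendsto_inner_weak_tendsto assms bounded_x tendsto_inner tendsto_const lims)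
    moreover have "((\<lambda>k. 1 / \<beta> * (norm (B (x k) - B xh))\<^sup>2) \<longlongrightarrow> 1 / \<beta> * (norm (B p - B xh))\<^sup>2) G"
      by (intro tendsto_intros lims)
    ultimately have "1 / \<beta> * (norm (B p - B xh))\<^sup>2 \<le> inner (xh - xh) (B p - B xh)"
      using B_cocoercive[of "x _" xh] by (intro tendsto_le[OF \<open>G \<noteq> bot\<close>]) (auto simp: inner_commute)
    then show ?thesis using \<beta> by (simp add: divide_le_0_iff)
  qed
  have wy: "weak_tendsto y xh G"
    using weak_tendsto_diff[OF assms(3) tendsto_imp_weak_tendsto[OF lims(1)]] by simp
  have wa: "weak_tendsto a ah G"
    unfolding a' ah_def by (intro weak_tendsto_scaleR inv weak_tendsto_diff assms)
  have "weak_tendsto (\<lambda>k. s k - a k) (- B p - ah) G"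
    by (intro weak_tendsto_diff tendsto_imp_weak_tendsto s_lim wa)
  then have wb: "weak_tendsto b (- B p - ah) G" by (simp flip: ab)
  have bzx: "bounded (range (\<lambda>k. z k - x k))"
    using bounded_minus_comp[OF bounded_z bounded_x] by simp
  \<comment> \<open>A rewriting of the summed pairings in which every product has a norm-convergent
    factor; \<open>1 / \<gamma> k\<close> moves to the residual so that the weak factor is visibly
    bounded.\<close>
  have "((\<lambda>k. inner (z k - x k) ((1 / \<gamma> k) *\<^sub>R (x k - y k)) + inner (x k) (s k) - inner (x k - y k) (s k))
    \<longlongrightarrow> inner (zh - xh) ((1 / \<gamma>bar) *\<^sub>R 0) + inner xh (- B p) - inner 0 (- B p)) G"
    by (intro tendsto_diff tendsto_add tendsto_inner_weak_tendsto weak_tendsto_diff bzx bounded_x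
        tendsto_inner tendsto_scaleR assms lims inv s_lim)
  moreover have "inner (z k - x k) ((1 / \<gamma> k) *\<^sub>R (x k - y k)) + inner (x k) (s k) - inner (x k - y k) (s k)
    = inner (a k) (x k) + inner (b k) (y k)" for k
  proof -
    have "inner (z k - x k) ((1 / \<gamma> k) *\<^sub>R (x k - y k)) = inner (a k) (x k - y k)"
      by (simp add: a')
    then show ?thesis by (simp add: inner_simps inner_commute flip: ab)
  qed
  ultimately have pairing: "((\<lambda>k. inner (a k) (x k) + inner (b k) (y k)) \<longlongrightarrow> inner (ah + (- B p - ah)) xh) G"
    by (simp add: inner_commute)
  have "ah \<in> A1 xh" "- B p - ah \<in> A2 xh"
    using demiclosed_pair[OF A1 a A2 b assms(3) wy wa wb pairing assms(2)] by auto
  then show ?thesis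
    unfolding zero_pair_def ah_def[symmetric] Bxh by (simp add: minus_diff_commute[of ah])
qed

end

section \<open>Fixed points and identification of the weak limits\<close>

lemma zero_pair_resolvents:
  assumes "zero_pair p u"
  shows "resolvent (op_scale \<gamma>bar A1) (p + \<gamma>bar *\<^sub>R u) = p"
    and "resolvent (op_scale \<gamma>bar A2) (2 *\<^sub>R p - (p + \<gamma>bar *\<^sub>R u) - \<gamma>bar *\<^sub>R B p) = p"
proof -
  have "2 *\<^sub>R p - (p + \<gamma>bar *\<^sub>R u) - \<gamma>bar *\<^sub>R B p - p = \<gamma>bar *\<^sub>R (- u - B p)"
    by (simp add: algebra_simps scaleR_2)
  then show "resolvent (op_scale \<gamma>bar A2) (2 *\<^sub>R p - (p + \<gamma>bar *\<^sub>R u) - \<gamma>bar *\<^sub>R B p) = p"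
    unfolding resolvent_scale_eq_iff[OF A2 \<gamma>bar_pos]
    using assms \<gamma>bar_pos by (simp only: zero_pair_def) simp
  show "resolvent (op_scale \<gamma>bar A1) (p + \<gamma>bar *\<^sub>R u) = p"
    unfolding resolvent_scale_eq_iff[OF A1 \<gamma>bar_pos] using assms \<gamma>bar_pos by (simp add: zero_pair_def)
qed

lemma zero_pair_Fix_davis_yin:
  assumes "zero_pair p u"
  shows "p + \<gamma>bar *\<^sub>R u \<in> Fix (davis_yin \<theta> \<gamma>bar A1 A2 B)"
  using zero_pair_resolvents[OF assms] by (simp add: Fix_def davis_yin_def DY_x1_def DY_x2_def)

lemma weak_convergence:
  assumes "zer (op_add (op_add A1 A2) (\<lambda>x. {B x})) \<noteq> {}"
  obtains p u where "zero_pair p u"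
    "weakly_converges z (p + \<gamma>bar *\<^sub>R u)" "weakly_converges w (p + \<gamma>bar *\<^sub>R u)"
    "weakly_converges x p" "weakly_converges y p"
proof -
  obtain p0 u0 where pu0: "zero_pair p0 u0" using assms zero_pairE by blast
  note bz = bounded_z[OF pu0] and bx = bounded_x[OF pu0]
    and res = residual_tendsto_0[OF pu0] and cluster = weak_cluster_point_zero_pair[OF pu0]
  \<comment> \<open>Refining the filter makes \<open>x\<close> converge weakly as well, so each
    cluster point of \<open>z\<close> is the fixed point of some zero pair. Its distance to
    \<open>z k\<close> then converges, as Opial's argument requires.\<close>
  have joint: "\<exists>H xh. H \<le> G \<and> H \<noteq> bot \<and> weak_tendsto z zh H \<and> weak_tendsto x xh H
      \<and> zero_pair xh ((1 / \<gamma>bar) *\<^sub>R (zh - xh))"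
    if G: "G \<le> sequentially" "G \<noteq> bot" "weak_tendsto z zh G" for G zh
  proof -
    obtain H xh where H: "H \<le> G" "H \<noteq> bot" "weak_tendsto x xh H"
      using bounded_imp_weak_cluster_point[OF bx G(2)] by blast
    moreover have "weak_tendsto z zh H" using G(3) H(1) by (rule weak_tendsto_mono)
    ultimately show ?thesis using cluster order_trans[OF H(1) G(1)] by blast
  qed
  have sum_eq: "xh + \<gamma>bar *\<^sub>R ((1 / \<gamma>bar) *\<^sub>R (zh - xh)) = zh" for xh zh :: 'a
    using \<gamma>bar_pos by simp
  have norm_lim: "convergent (\<lambda>k. norm (z k - zh))"
    if "G \<le> sequentially" "G \<noteq> bot" "weak_tendsto z zh G" for G zh
    using joint[OF that] convergent_norm_z_diff sum_eq by metis
  obtain G zh where G: "G \<le> sequentially" "G \<noteq> bot" "weak_tendsto z zh G"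
    using bounded_imp_weak_cluster_point[OF bz] by (metis sequentially_bot)
  have z_uniq: "zh' = zh" if "G' \<le> sequentially" "G' \<noteq> bot" "weak_tendsto z zh' G'" for G' zh'
    using norm_lim[OF that] norm_lim[OF G] weak_cluster_points_eq[OF _ _ that G]
    by (auto simp: convergent_def)
  have z_lim: "weak_tendsto z zh sequentially"
    using weak_tendsto_if_unique_cluster_point[OF bz] z_uniq by metis
  obtain p where p: "zero_pair p ((1 / \<gamma>bar) *\<^sub>R (zh - p))"
    using joint[OF G] by blast
  \<comment> \<open>With \<open>z\<close> converging to \<open>zh\<close>, every cluster point of
    \<open>x\<close> is the resolvent of \<open>A1\<close> at \<open>zh\<close>.\<close>
  have x_uniq: "xh = p" if G': "G' \<le> sequentially" "G' \<noteq> bot" "weak_tendsto x xh G'" for G' xh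
  proof -
    have "zero_pair xh ((1 / \<gamma>bar) *\<^sub>R (zh - xh))"
      using cluster[OF G'(1,2,3)] weak_tendsto_mono[OF z_lim G'(1)] by blast
    from zero_pair_resolvents(1)[OF this] zero_pair_resolvents(1)[OF p] show ?thesis
      unfolding sum_eq by simp
  qed
  have x_lim: "weak_tendsto x p sequentially"
    using weak_tendsto_if_unique_cluster_point[OF bx] x_uniq by metis
  have y_lim: "weak_tendsto y p sequentially"
    using weak_tendsto_diff[OF x_lim tendsto_imp_weak_tendsto[OF res]] by simp
  \<comment> \<open>Eventually \<open>\<rho> k\<close> is at most 1, so \<open>w\<close> and
    \<open>z\<close> differ by a null sequence.\<close>
  have "(\<lambda>k. \<rho> k *\<^sub>R (x k - y k)) \<longlonglongrightarrow> 0"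
  proof (rule Lim_null_comparison)
    show "\<forall>\<^sub>F k in sequentially. norm (\<rho> k *\<^sub>R (x k - y k)) \<le> norm (x k - y k)"
      using \<rho>_le
    proof eventually_elim
      case (elim k)
      have "0 \<le> \<beta> * \<gamma> k" using \<beta> \<gamma>_pos[of k] by simp
      then have "0 \<le> \<rho> k" "\<rho> k \<le> 1" using elim c(1) c(2)[of k] by linarith+
      then show ?case by (simp add: mult_left_le_one_le)
    qed
  qed (use res in \<open>simp add: tendsto_norm_zero_iff\<close>)
  from weak_tendsto_diff[OF z_lim tendsto_imp_weak_tendsto[OF this]]
  have w_lim: "weak_tendsto w zh sequentially" by (simp flip: w_eq)
  show thesis
    using that[OF p] z_lim w_lim x_lim y_lim unfolding sum_eq
    by (simp add: weak_tendsto_def weakly_converges_def)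
qed

end

theorem corollary5p7:
  fixes A1 A2 :: "'a::{real_inner, complete_space} \<Rightarrow> 'a set"
    and B :: "'a \<Rightarrow> 'a"
    and \<beta> \<gamma>bar :: real
    and \<Gamma> :: "real set"
    and \<gamma> \<theta> lam :: "nat \<Rightarrow> real"
    and z0 :: 'a
    and x y z w :: "nat \<Rightarrow> 'a"
  assumes "maximally_monotone A1"
    and "maximally_monotone A2"
    and "\<beta> > 0"
    and "cocoercive \<beta> B"
    and "zer (op_add (op_add A1 A2) (\<lambda>x. {B x})) \<noteq> {}"
    and "\<Gamma> \<subseteq> {0<..<2 / \<beta>}"
    and "\<And>k. \<gamma> k \<in> \<Gamma>"
    and "\<gamma>bar \<in> \<Gamma>"
    and "\<gamma> \<longlonglongrightarrow> \<gamma>bar"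
    and "summable (\<lambda>k. max (\<gamma> (Suc k) - \<gamma> k) 0)"
    and "\<And>k. \<theta> k > 0"
    and "bounded (range \<theta>)"
    and "separated_from_zero \<theta>"
    and "\<And>k. lam k > 0"
    and "separated_from_zero lam"
    and "liminf (\<lambda>k. ereal (2 - \<beta> * \<gamma> k - 2 * lam k * \<theta> k)) > 0"
    and "z 0 = z0"
    and "x 0 = resolvent (op_scale (\<gamma> 0) A1) z0"
    and "\<And>k. y k = resolvent (op_scale (\<gamma> k) A2) (2 *\<^sub>R x k - z k - \<gamma> k *\<^sub>R B (x k))"
    and "\<And>k. w k = z k + (lam k * \<theta> k) *\<^sub>R (y k - x k)"
    and "\<And>k. x (Suc k) = resolvent (op_scale (\<gamma> k) A1) (w k)"
    and "\<And>k. z (Suc k) = (\<gamma> (Suc k) / \<gamma> k) *\<^sub>R w k + (1 - \<gamma> (Suc k) / \<gamma> k) *\<^sub>R x (Suc k)"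
  shows "\<exists>zbar xbar.
      (weakly_converges z zbar \<and> weakly_converges w zbar \<and>
       zbar \<in> Fix (davis_yin (real_of_ereal (liminf (\<lambda>k. ereal (\<theta> k)))) \<gamma>bar A1 A2 B)) \<and>
      (weakly_converges x xbar \<and> weakly_converges y xbar \<and>
       xbar = resolvent (op_scale \<gamma>bar A1) zbar \<and>
       xbar \<in> zer (op_add (op_add A1 A2) (\<lambda>x. {B x})))"
proof -
  have \<gamma>_pos: "0 < \<gamma> k" "\<gamma> k < 2 / \<beta>" for k
    using assms(6) assms(7)[of k] by auto
  have \<gamma>bar_pos: "0 < \<gamma>bar"
    using assms(6,8) by auto
  \<comment> \<open>A uniform lower bound on the stepsizes comes from their positive limit: the
    reciprocals converge and hence are bounded by some \<open>K\<close>.\<close>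
  have "(\<lambda>k. 1 / \<gamma> k) \<longlonglongrightarrow> 1 / \<gamma>bar"
    using \<gamma>bar_pos by (intro tendsto_intros assms(9)) simp
  then have "Bseq (\<lambda>k. 1 / \<gamma> k)" by (rule convergent_imp_Bseq[OF convergentI])
  then obtain K where K: "0 < K" "\<And>k. norm (1 / \<gamma> k) \<le> K" by (auto simp: Bseq_def)
  have m: "1 / K \<le> \<gamma> k" for k
    using K(1) K(2)[of k] \<gamma>_pos(1)[of k] by (simp add: field_simps)
  obtain c1 c2 where c: "0 < c1" "\<And>k. c1 \<le> lam k" "0 < c2" "\<And>k. c2 \<le> \<theta> k"
    using assms(13,15) unfolding separated_from_zero_def by blast
  define a where "a k = (1 / \<gamma> k) *\<^sub>R (z k - x k)" for k
  define b where "b k = (1 / \<gamma> k) *\<^sub>R (2 *\<^sub>R x k - z k - \<gamma> k *\<^sub>R B (x k) - y k)" for k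
  have x_Suc: "(1 / \<gamma> k) *\<^sub>R (w k - x (Suc k)) \<in> A1 (x (Suc k))" for k
    using resolvent_scale_eq_iff[OF assms(1) \<gamma>_pos(1)] assms(21)[of k] by metis
  \<comment> \<open>The correction scales the offset from \<open>x (Suc k)\<close> by the stepsize
    ratio, so dividing by the new stepsize gives the element of \<open>A1\<close> produced with the
    old one.\<close>
  have a_Suc: "a (Suc k) = (1 / \<gamma> k) *\<^sub>R (w k - x (Suc k))" for k
  proof -
    have "z (Suc k) - x (Suc k) = (\<gamma> (Suc k) / \<gamma> k) *\<^sub>R (w k - x (Suc k))"
      unfolding assms(22) by (simp add: algebra_simps)
    then show ?thesis using \<gamma>_pos(1)[of "Suc k"] by (simp add: a_def)
  qed
  have a_in: "a k \<in> A1 (x k)" for k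
  proof (cases k)
    case 0
    then show ?thesis
      using resolvent_scale_eq_iff[OF assms(1) \<gamma>_pos(1)] assms(17,18) unfolding a_def by metis
  qed (simp add: a_Suc x_Suc)
  have b_in: "b k \<in> A2 (y k)" for k
    using resolvent_scale_eq_iff[OF assms(2) \<gamma>_pos(1)] assms(19)[of k] unfolding b_def by metis
  have c_le: "c1 * c2 \<le> lam k * \<theta> k" for k
    using c(1,3) c(2,4)[of k] by (intro mult_mono) auto
  \<comment> \<open>A positive lower limit makes the expression eventually positive; halve
    it.\<close>
  have ev_le: "\<forall>\<^sub>F k in sequentially. lam k * \<theta> k \<le> 1 - \<beta> * \<gamma> k / 2"
    using less_LiminfD[OF assms(16)] by eventually_elim simp
  have b_eq: "\<gamma> k *\<^sub>R (a k + b k + B (x k)) = x k - y k" for k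
    using \<gamma>_pos(1)[of k] by (simp add: a_def b_def scaleR_add_right scaleR_2)
  have w_eq': "w k = x (Suc k) + \<gamma> k *\<^sub>R a (Suc k)" for k
    using \<gamma>_pos(1)[of k] by (simp add: a_Suc)
  have w_eq: "w k = z k - (lam k * \<theta> k) *\<^sub>R (x k - y k)" for k
    unfolding assms(20) by (simp add: algebra_simps)
  have z_eq: "z k = x k + \<gamma> k *\<^sub>R a k" for k
    using \<gamma>_pos(1)[of k] by (simp add: a_def)
  interpret davis_yin_iteration A1 A2 B \<beta> \<gamma>bar "1 / K" "c1 * c2" \<gamma> "\<lambda>k. lam k * \<theta> k" x y z w a b
  proof (rule davis_yin_iteration.intro)
    show "0 < 1 / K" "0 < c1 * c2" using K(1) c(1,3) by simp_all
  qed (fact assms(1-4,9,10) m \<gamma>_pos a_in b_in c_le ev_le b_eq w_eq w_eq' z_eq)+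
  obtain p u where "zero_pair p u"
    "weakly_converges z (p + \<gamma>bar *\<^sub>R u)" "weakly_converges w (p + \<gamma>bar *\<^sub>R u)"
    "weakly_converges x p" "weakly_converges y p"
    using weak_convergence[OF assms(5)] by blast
  then show ?thesis
    using zero_pair_Fix_davis_yin zero_pair_resolvents(1) zero_pair_zer by metis
qed

end
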